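(* Let $p\ge 2$ and $n\ge p+1$ be integers and put $r=\min\{p,2(n-p)\}$. Let $\mathcal T$ be the cubature defect of the tensor Gauss rule $\mathcal G_n$ on $[-1,1]^3$, $\mathcal T(z;u,v)=\mathcal G_n[D z:(Du\times Dv)]-\int_{[-1,1]^3}Dz:(Du\times Dv)\,d\xi$. Then $$\{z\in\mathbb Q_p^3:\ \mathcal T(z;u,v)=0\ \text{ for all }u,v\in\mathbb Q_p^3\}=\mathbb Q_r^3 .$$ For $p=1$ and $n\ge2$, every $z\in\mathbb Q_1^3$ satisfies $\mathcal T(z;u,v)=0$ for all $u,v\in\mathbb Q_1^3$.
   Context: $\mathbb Q_p$ is the space of real scalar polynomials in three variables on $[-1,1]^3$ of degree at most $p$ in each coordinate; $\mathbb Q_p^3$ denotes vector fields with all three components in $\mathbb Q_p$. $\mathcal G_n$ is the tensor-product Gauss--Legendre rule with $n$ points per coordinate on $[-1,1]^3$. For a vector field $z$, $Dz$ is its Jacobian matrix (rows indexed by vector components, columns by coordinates). For $A,B\in\mathbb R^{3\times3}$: $A:B=\operatorname{tr}(A^TB)$; $\operatorname{cof}A$ is the matrix of signed $2\times2$ minors ($\operatorname{cof}A=(\det A)A^{-T}$ for invertible $A$); and $A\times B=\operatorname{cof}(A+B)-\operatorname{cof}A-\operatorname{cof}B$, a symmetric bilinear operation. *)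

theory Defs
  imports "HOL-Analysis.Analysis" "HOL-Computational_Algebra.Polynomial"
begin

text \<open>
  Polynomials in three variables are represented by the functions on \<open>real^3\<close> they induce.
  Restriction to \<open>[-1,1]^3\<close> is injective on them, so nothing is lost by letting them live on
  the whole space.
\<close>

definition Qsp :: "nat \<Rightarrow> (real^3 \<Rightarrow> real) set" where
  "Qsp p = {f. \<exists>c :: nat \<Rightarrow> nat \<Rightarrow> nat \<Rightarrow> real. \<forall>x.
     f x = (\<Sum>i\<le>p. \<Sum>j\<le>p. \<Sum>k\<le>p. c i j k * (x$1)^i * (x$2)^j * (x$3)^k)}"

definition Qvec :: "nat \<Rightarrow> (real^3 \<Rightarrow> real^3) set" where
  "Qvec p = {z. \<forall>m. (\<lambda>x. z x $ m) \<in> Qsp p}"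

definition frobenius :: "real^3^3 \<Rightarrow> real^3^3 \<Rightarrow> real" where
  "frobenius A B = trace (transpose A ** B)"

definition cof :: "real^3^3 \<Rightarrow> real^3^3" where
  "cof A = vector [
     vector [A$2$2 * A$3$3 - A$2$3 * A$3$2,
             - (A$2$1 * A$3$3 - A$2$3 * A$3$1),
             A$2$1 * A$3$2 - A$2$2 * A$3$1],
     vector [- (A$1$2 * A$3$3 - A$1$3 * A$3$2),
             A$1$1 * A$3$3 - A$1$3 * A$3$1,
             - (A$1$1 * A$3$2 - A$1$2 * A$3$1)],
     vector [A$1$2 * A$2$3 - A$1$3 * A$2$2,
             - (A$1$1 * A$2$3 - A$1$3 * A$2$1),
             A$1$1 * A$2$2 - A$1$2 * A$2$1]]"

definition mat_cross :: "real^3^3 \<Rightarrow> real^3^3 \<Rightarrow> real^3^3" where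
  "mat_cross A B = cof (A + B) - cof A - cof B"

text \<open>Legendre polynomials by Rodrigues' formula.\<close>

definition legendre :: "nat \<Rightarrow> real poly" where
  "legendre n = smult (1 / (2 ^ n * fact n)) ((pderiv ^^ n) ([:-1, 0, 1:] ^ n))"

definition gauss_nodes :: "nat \<Rightarrow> real set" where
  "gauss_nodes n = {x. poly (legendre n) x = 0}"

text \<open>The weight of a node is the integral of its Lagrange basis polynomial.\<close>

definition gauss_weight :: "nat \<Rightarrow> real \<Rightarrow> real" where
  "gauss_weight n x =
     integral {-1..1} (\<lambda>t. \<Prod>y\<in>gauss_nodes n - {x}. (t - y) / (x - y))"

definition tensor_gauss :: "nat \<Rightarrow> (real^3 \<Rightarrow> real) \<Rightarrow> real" where
  "tensor_gauss n f =
     (\<Sum>a\<in>gauss_nodes n. \<Sum>b\<in>gauss_nodes n. \<Sum>c\<in>gauss_nodes n.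
        gauss_weight n a * gauss_weight n b * gauss_weight n c * f (vector [a, b, c]))"

definition defect ::
  "nat \<Rightarrow> (real^3 \<Rightarrow> real^3) \<Rightarrow> (real^3 \<Rightarrow> real^3) \<Rightarrow> (real^3 \<Rightarrow> real^3) \<Rightarrow> real" where
  "defect n z u v =
     (let F = (\<lambda>x. frobenius (jacobian z (at x))
                      (mat_cross (jacobian u (at x)) (jacobian v (at x))))
      in tensor_gauss n F - integral (cbox (-1) 1) F)"

lemma cof_mult_transpose: "A ** transpose (cof A) = det A *\<^sub>R mat 1"
  by (simp add: vec_eq_iff forall_3 matrix_matrix_mult_def transpose_def sum_3 cof_def
      vector_3 mat_def det_3 algebra_simps)

end

(*
  The integrand D z : (D u \<times> D v) is the alternating sum of the determinants of the gradients of
  z_i, u_j, v_k, so the claim decouples: a scalar f in Q_p must be shown to lie in Q_r iff the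
  defect of det (grad f, grad g, grad h) vanishes for all g, h in Q_p. If f is in Q_r, the integrand
  has degree at most 2p + r - 1 <= 2n - 1 in every coordinate and the rule is exact. Conversely,
  taking the difference of the conditions for (x_b G, H) and (G, x_b H) leaves the defect of the
  plane Jacobian of f and W = G H in the two other coordinates. Let s > r be the largest degree of
  f in x_a. Choosing W of degree 2n + 1 - s in x_a, and of low degree in the remaining coordinates,
  only the coefficient of x_a^(2n) contributes; the one-dimensional defect of t^(2n) is nonzero, so
  the top coefficient of f in x_a satisfies moment conditions that force it to vanish.
*)
theory Submission
  imports Defs
begin

section \<open>Gauss quadrature on the interval\<close>

definition pint :: "real poly \<Rightarrow> real" where
  "pint q = integral {-1..1} (poly q)"

lemma poly_integrable: "poly q integrable_on {-1..1::real}"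
  by (intro integrable_continuous_real continuous_intros)

lemma pint_0 [simp]: "pint 0 = 0"
  unfolding pint_def poly_0[abs_def] by simp

lemma pint_add: "pint (p + q) = pint p + pint q"
  unfolding pint_def poly_add[abs_def] by (intro integral_add poly_integrable)

lemma pint_smult: "pint (smult c p) = c * pint p"
  unfolding pint_def poly_smult[abs_def] by simp

lemma pint_sum: "pint (\<Sum>i\<in>A. f i) = (\<Sum>i\<in>A. pint (f i))"
  by (induction A rule: infinite_finite_induct) (auto simp: pint_add)

lemma pint_pderiv: "pint (pderiv q) = poly q 1 - poly q (-1)"
  unfolding pint_def
  by (intro integral_unique fundamental_theorem_of_calculus)
     (auto intro: DERIV_subset poly_DERIV
        simp: has_real_derivative_iff_has_vector_derivative[symmetric])

lemma pint_by_parts: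
  "pint (pderiv a * b) = poly (a * b) 1 - poly (a * b) (-1) - pint (a * pderiv b)"
  using pint_pderiv[of "a * b"] by (simp add: pderiv_mult pint_add mult.commute)

text \<open>A continuous nonnegative integrand with zero integral vanishes on the whole interval,
  and only the zero polynomial has infinitely many roots. This definiteness gives both the failure
  of the rule at degree \<open>2 * n\<close> and the regularity of the moment matrix.\<close>

lemma pint_square_eq_0_iff: "pint (q * q) = 0 \<longleftrightarrow> q = 0"
proof
  assume "pint (q * q) = 0"
  then have "poly (q * q) x = 0" if "x \<in> {-1..1}" for x
    using that unfolding pint_def
    by (intro integral_eq_0_iff[THEN iffD1, rule_format, of "-1" 1 "poly (q*q)"])
       (auto intro!: continuous_intros)
  then have "{-1..1} \<subseteq> {x. poly (q * q) x = 0}" by blast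
  then have "infinite {x. poly (q * q) x = 0}"
    by (rule infinite_super) simp
  with poly_roots_finite show "q = 0" by fastforce
qed simp

lemma pint_monom: "pint (monom 1 k) = (1 + (-1)^k) / real (k + 1)"
proof -
  have "monom 1 k = smult (1 / real (k + 1)) (pderiv (monom 1 (k + 1)))"
    by (simp add: pderiv_monom smult_monom)
  then show ?thesis
    by (simp add: pint_smult pint_pderiv poly_monom)
qed

section \<open>Orthogonality and roots of the Legendre polynomials\<close>

lemma dvd_pderiv_power:
  assumes "q ^ Suc m dvd p"
  shows "q ^ m dvd pderiv (p :: real poly)"
proof -
  obtain r where "p = q ^ Suc m * r" using assms by blast
  then have "pderiv p = q ^ m * (smult (of_nat (Suc m)) (pderiv q) * r + q * pderiv r)"
    by (simp add: pderiv_mult pderiv_power_Suc del: power_Suc) (simp add: algebra_simps)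
  then show ?thesis by simp
qed

text \<open>For \<open>k = n\<close> this is the Legendre polynomial up to a constant factor; the
  lower derivatives are there for induction on \<open>k\<close>.\<close>

abbreviation rodrigues :: "nat \<Rightarrow> nat \<Rightarrow> real poly" where
  "rodrigues n k \<equiv> (pderiv ^^ k) ([:-1, 0, 1:] ^ n)"

text \<open>Each differentiation costs at most one factor \<open>t^2 - 1\<close>, so
  \<open>n - k\<close> of them are left.\<close>

lemma rodrigues_endpoints:
  assumes "k < n" "x \<in> {-1, 1}"
  shows "poly (rodrigues n k) x = 0"
proof -
  have "[:-1, 0, 1:] ^ (n - k) dvd rodrigues n k" if "k \<le> n" for k
    using that
  proof (induction k)
    case (Suc k)
    then have "[:-1, 0, 1:] ^ Suc (n - Suc k) dvd rodrigues n k"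
      by (simp add: Suc_diff_Suc)
    from dvd_pderiv_power[OF this] show ?case by simp
  qed simp
  then have "[:-1, 0, 1:] ^ (n - k) dvd rodrigues n k" using assms by simp
  then obtain r where "rodrigues n k = [:-1, 0, 1:] ^ (n - k) * r" by blast
  then show ?thesis using assms by (auto simp: power_0_left)
qed

text \<open>Integration by parts moves one derivative at a time onto \<open>q\<close>. The boundary
  terms vanish by \<open>rodrigues_endpoints\<close>, and \<open>q\<close> is differentiated away
  before the derivatives run out.\<close>

lemma rodrigues_orthogonal:
  assumes "k \<le> n" "degree q < k"
  shows "pint (rodrigues n k * q) = 0"
  using assms
proof (induction k arbitrary: q)
  case (Suc k)
  have "pint (rodrigues n (Suc k) * q) = - pint (rodrigues n k * pderiv q)"
    using Suc.prems by (simp add: pint_by_parts rodrigues_endpoints)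
  moreover have "pint (rodrigues n k * pderiv q) = 0"
  proof (cases "degree q")
    case 0
    then show ?thesis by (simp add: pderiv_eq_0_iff[THEN iffD2])
  next
    case (Suc d)
    then show ?thesis using Suc.IH Suc.prems by (simp add: degree_pderiv)
  qed
  ultimately show ?case by simp
qed simp

text \<open>Rolle between consecutive points, with the largest point added last. Confining
  \<open>T\<close> to the open span of \<open>S\<close> keeps the new root, which lies beyond
  \<open>Max A\<close>, distinct from the earlier ones.\<close>

lemma rolle_roots:
  fixes p :: "real poly"
  assumes "finite S" "S \<noteq> {}" "\<And>x. x \<in> S \<Longrightarrow> poly p x = 0"
  shows "\<exists>T. finite T \<and> card T = card S - 1 \<and> T \<subseteq> {Min S<..<Max S} \<and> (\<forall>x\<in>T. poly (pderiv p) x = 0)"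
  using assms
proof (induction S rule: finite_linorder_max_induct)
  case (insert b A)
  show ?case
  proof (cases "A = {}")
    case True
    then show ?thesis by (intro exI[of _ "{}"]) auto
  next
    case False
    then obtain T where T: "finite T" "card T = card A - 1" "T \<subseteq> {Min A<..<Max A}"
      "\<forall>x\<in>T. poly (pderiv p) x = 0"
      using insert by auto
    have "Max A < b" using insert False by simp
    moreover have "poly p (Max A) = 0" "poly p b = 0"
      using insert False Max_in by auto
    ultimately obtain y where y: "Max A < y" "y < b" "poly (pderiv p) y = 0"
      using poly_MVT[of "Max A" b p] by auto
    have "Min A \<le> Max A" using insert.hyps(1) False by simp
    moreover have "Min (insert b A) = Min A" "Max (insert b A) = b"
      using insert.hyps(1) False \<open>Max A < b\<close> \<open>Min A \<le> Max A\<close> by auto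
    moreover have "y \<notin> T" "b \<notin> A" using T y insert.hyps by auto
    moreover have "card A > 0" using insert.hyps(1) False by (simp add: card_gt_0_iff)
    ultimately show ?thesis
      using T y insert.hyps(1) by (intro exI[of _ "insert y T"]) force
  qed
qed simp

text \<open>Before step \<open>n\<close> the endpoints are roots as well: together with the
  \<open>k\<close> interior roots they make \<open>k + 2\<close>, and Rolle returns
  \<open>k + 1\<close> roots strictly inside.\<close>

lemma rodrigues_roots:
  assumes "k \<le> n"
  shows "\<exists>T. finite T \<and> card T = k \<and> T \<subseteq> {-1<..<1} \<and> (\<forall>x\<in>T. poly (rodrigues n k) x = 0)"
  using assms
proof (induction k)
  case (Suc k)
  then obtain T where T: "finite T" "card T = k" "T \<subseteq> {-1<..<1}"
    "\<forall>x\<in>T. poly (rodrigues n k) x = 0" by auto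
  let ?S = "insert (-1) (insert 1 T)"
  have "\<And>x. x \<in> ?S \<Longrightarrow> poly (rodrigues n k) x = 0"
    using T rodrigues_endpoints[of k n] Suc.prems by auto
  moreover have "Min ?S = -1" "Max ?S = 1"
    using T(1,3) by (intro Min_eqI Max_eqI; auto simp: less_imp_le subset_iff)+
  moreover have "(1::real) \<notin> T" "-1 \<notin> insert 1 T" using T(3) by auto
  then have "card ?S = k + 2" using T(1,2) by simp
  ultimately show ?case
    using rolle_roots[of ?S "rodrigues n k"] T(1) by auto
qed (auto intro: exI[of _ "{}"])

lemma degree_rodrigues: "degree (rodrigues n k) = 2 * n - k"
  by (induction k) (auto simp: degree_power_eq degree_pderiv)

lemma degree_legendre: "degree (legendre n) = n"
  by (simp add: legendre_def degree_rodrigues)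

lemma legendre_nonzero: "legendre n \<noteq> 0"
proof (cases "n = 0")
  case True
  then show ?thesis by (simp add: legendre_def)
next
  case False
  then show ?thesis using degree_legendre[of n] by force
qed

lemma finite_gauss_nodes: "finite (gauss_nodes n)"
  unfolding gauss_nodes_def by (rule poly_roots_finite[OF legendre_nonzero])

text \<open>The degree bounds the number of roots from above, and Rolle supplies \<open>n\<close>
  distinct real ones.\<close>

lemma card_gauss_nodes: "card (gauss_nodes n) = n"
proof (rule antisym)
  show "card (gauss_nodes n) \<le> n"
    unfolding gauss_nodes_def
    using card_poly_roots_bound[OF legendre_nonzero, of n] by (simp add: degree_legendre)
  obtain T where T: "finite T" "card T = n" "\<forall>x\<in>T. poly (rodrigues n n) x = 0"
    using rodrigues_roots[of n n] by auto
  then have "T \<subseteq> gauss_nodes n" by (auto simp: gauss_nodes_def legendre_def)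
  then show "n \<le> card (gauss_nodes n)"
    using card_mono[OF finite_gauss_nodes] T(2) by metis
qed

lemma legendre_orthogonal: "degree q < n \<Longrightarrow> pint (legendre n * q) = 0"
  by (simp add: legendre_def rodrigues_orthogonal pint_smult)

section \<open>Interpolatory weights and the degree of exactness\<close>

definition gauss :: "nat \<Rightarrow> real poly \<Rightarrow> real" where
  "gauss n q = (\<Sum>a\<in>gauss_nodes n. gauss_weight n a * poly q a)"

definition lagrange :: "nat \<Rightarrow> real \<Rightarrow> real poly" where
  "lagrange n x = (\<Prod>y\<in>gauss_nodes n - {x}. [:- y / (x - y), 1 / (x - y):])"

lemma gauss_weight_pint: "gauss_weight n x = pint (lagrange n x)"
  unfolding gauss_weight_def pint_def lagrange_def
  by (intro arg_cong[where f = "integral _"] ext)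
     (auto simp: poly_prod diff_divide_distrib intro!: prod.cong)

lemma poly_lagrange:
  assumes "x \<in> gauss_nodes n" "a \<in> gauss_nodes n"
  shows "poly (lagrange n x) a = (if a = x then 1 else 0)"
proof (cases "a = x")
  case True
  then show ?thesis
    by (auto simp: lagrange_def poly_prod divide_simps intro!: prod.neutral)
next
  case False
  then show ?thesis using assms finite_gauss_nodes
    by (auto simp: lagrange_def poly_prod intro!: prod_zero bexI[of _ a] simp: field_simps)
qed

lemma degree_lagrange:
  assumes "x \<in> gauss_nodes n"
  shows "degree (lagrange n x) < n"
proof -
  have "degree (lagrange n x) \<le> (\<Sum>y\<in>gauss_nodes n - {x}. degree [:- y / (x - y), 1 / (x - y):])"
    unfolding lagrange_def by (rule degree_prod_sum_le[unfolded o_def]) (simp add: finite_gauss_nodes)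
  also have "\<dots> \<le> (\<Sum>y\<in>gauss_nodes n - {x}. 1)"
    by (intro sum_mono) simp
  also have "\<dots> = n - 1" using assms by (simp add: card_gauss_nodes)
  finally show ?thesis
    using assms card_gauss_nodes[of n] finite_gauss_nodes[of n] card_gt_0_iff[of "gauss_nodes n"] by auto
qed

text \<open>Such a \<open>q\<close> equals its Lagrange interpolant at the \<open>n\<close> nodes,
  and the weights are the integrals of the Lagrange polynomials.\<close>

lemma gauss_interpolation:
  assumes "degree q < n"
  shows "gauss n q = pint q"
proof -
  let ?r = "\<Sum>x\<in>gauss_nodes n. smult (poly q x) (lagrange n x)"
  have "degree ?r < n"
    using assms
    by (intro degree_sum_less le_less_trans[OF degree_smult_le degree_lagrange]) auto
  moreover have "poly q a = poly ?r a" if "a \<in> gauss_nodes n" for a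
    using that finite_gauss_nodes by (simp add: poly_sum poly_lagrange if_distrib[of "(*) _"] cong: if_cong)
  ultimately have "q = ?r"
    using assms by (intro poly_eqI_degree[of "gauss_nodes n"]) (simp_all add: card_gauss_nodes)
  then have "pint q = pint ?r" by (rule arg_cong)
  then show ?thesis
    by (simp add: pint_sum pint_smult gauss_def gauss_weight_pint mult.commute)
qed

lemma gauss_legendre_mult: "gauss n (legendre n * q) = 0"
  unfolding gauss_def by (intro sum.neutral) (auto simp: gauss_nodes_def)

lemma gauss_add: "gauss n (p + q) = gauss n p + gauss n q"
  by (simp add: gauss_def algebra_simps sum.distrib)

lemma gauss_smult: "gauss n (smult c p) = c * gauss n p"
  by (simp add: gauss_def sum_distrib_left mult_ac)

text \<open>Divide by the Legendre polynomial. Its multiple is annihilated by the rule, since the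
  nodes are roots, and by the integral, since the quotient has degree below \<open>n\<close>;
  interpolation handles the remainder.\<close>

lemma gauss_exact:
  assumes "degree q < 2 * n"
  shows "gauss n q = pint q"
proof -
  let ?L = "legendre n"
  have n: "n > 0" using assms by simp
  have q: "q = ?L * (q div ?L) + q mod ?L" by simp
  have "degree (q div ?L) < n"
  proof (cases "q div ?L = 0")
    case False
    have "degree (?L * (q div ?L)) = degree (q - q mod ?L)" by (simp add: minus_mod_eq_mult_div)
    also have "\<dots> < 2 * n"
      using assms degree_mod_less[OF legendre_nonzero, of q n] n
      by (intro degree_diff_less) (auto simp: degree_legendre)
    finally show ?thesis
      using False legendre_nonzero by (simp add: degree_mult_eq degree_legendre)
  qed (use n in simp)
  moreover have "degree (q mod ?L) < n"
    using degree_mod_less[OF legendre_nonzero, of q n] n by (auto simp: degree_legendre)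
  ultimately have "gauss n (?L * (q div ?L) + q mod ?L) = pint (?L * (q div ?L) + q mod ?L)"
    by (simp only: gauss_add pint_add gauss_legendre_mult legendre_orthogonal gauss_interpolation)
  then show ?thesis using q by simp
qed

text \<open>The square of the Legendre polynomial differs from a multiple of \<open>t^(2n)\<close>
  by a polynomial in the exact range. Exactness on \<open>t^(2n)\<close> would thus extend to the
  square, on which the rule gives zero but the integral does not.\<close>

lemma gauss_monom_defect:
  assumes "n > 0"
  shows "gauss n (monom 1 (2 * n)) \<noteq> pint (monom 1 (2 * n))"
proof
  let ?L = "legendre n" and ?m = "monom (1::real) (2 * n)"
  let ?l = "lead_coeff ?L"
  assume eq: "gauss n ?m = pint ?m"
  let ?q = "?L * ?L - smult (?l * ?l) ?m"
  have "degree ?q < 2 * n"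
  proof (rule degree_lessI)
    have "degree ?q \<le> 2 * n"
      by (intro degree_diff_le order.trans[OF degree_mult_le] order.trans[OF degree_smult_le])
         (auto simp: degree_legendre degree_monom_eq)
    moreover have "coeff ?q (2 * n) = 0"
      using coeff_mult_degree_sum[of ?L ?L] by (simp add: degree_legendre mult_2)
    ultimately show "\<forall>k\<ge>2 * n. coeff ?q k = 0"
      by (auto simp del: coeff_diff intro: coeff_eq_0 simp: le_less)
  qed (use assms in simp)
  then have "gauss n ?q = pint ?q" by (rule gauss_exact)
  moreover have "?L * ?L = ?q + smult (?l * ?l) ?m" by simp
  ultimately have "gauss n (?L * ?L) = pint (?L * ?L)"
    by (metis gauss_add pint_add gauss_smult pint_smult eq)
  then show False
    using pint_square_eq_0_iff legendre_nonzero by (simp add: gauss_legendre_mult)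
qed

section \<open>Moments on the interval\<close>

definition moment :: "nat \<Rightarrow> real" where
  "moment k = pint (monom 1 k)"

lemma moment_eq: "real (k + 1) * moment k = 1 + (-1) ^ k"
  by (simp add: moment_def pint_monom)

text \<open>Weighting the \<open>i\<close>-th condition by \<open>a i\<close> and summing gives the
  integral of the squared polynomial with coefficients \<open>a\<close>: the Gram matrix of the
  monomials is definite.\<close>

lemma moment_nondegenerate:
  assumes "\<And>i. i \<le> p \<Longrightarrow> (\<Sum>j\<le>p. a j * moment (j + i)) = 0" and "j \<le> p"
  shows "a j = 0"
proof -
  let ?q = "\<Sum>j\<le>p. monom (a j) j"
  have "?q * ?q = (\<Sum>j\<le>p. \<Sum>i\<le>p. smult (a i * a j) (monom 1 (j + i)))"
    by (simp add: sum_product smult_monom mult_monom mult.commute)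
  then have "pint (?q * ?q) = (\<Sum>j\<le>p. \<Sum>i\<le>p. a i * (a j * moment (j + i)))"
    by (simp add: pint_sum pint_smult moment_def mult.assoc)
  also have "\<dots> = (\<Sum>i\<le>p. a i * (\<Sum>j\<le>p. a j * moment (j + i)))"
    by (subst sum.swap) (simp add: sum_distrib_left)
  finally have "?q = 0"
    using assms(1) by (simp add: pint_square_eq_0_iff)
  then have "coeff ?q j = 0" by simp
  then show ?thesis
    using assms(2) by (simp add: coeff_sum sum.delta')
qed

text \<open>
  The hypothesis says that \<open>s * q' * f - A * q * f'\<close> has integral zero over \<open>[-1,1]\<close> for every
  polynomial \<open>q\<close> of degree at most \<open>p + 1\<close>, where \<open>f\<close> has the coefficients \<open>a\<close>. Integrating
  by parts, the moments of \<open>f\<close> up to order \<open>p\<close> are those of a constant, so \<open>f\<close> is that constant,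
  and then \<open>q = t\<close> forces it to be zero. The truncated \<open>k + i - 1\<close> is harmless: for
  \<open>k = i = 0\<close> the factor in front vanishes.
\<close>

lemma euler_moment_nondegenerate:
  fixes A s :: real
  assumes "A > 0" "s > 0"
    and *: "\<And>i. i \<le> p + 1 \<Longrightarrow> (\<Sum>k\<le>p. a k * (s * i - A * k) * moment (k + i - 1)) = 0"
    and "k \<le> p"
  shows "a k = 0"
proof -
  \<comment> \<open>\<open>v\<close> is \<open>f(1)\<close>, and \<open>w\<close> is the constant
    whose moments \<open>f\<close> turns out to share.\<close>
  define v where "v = (\<Sum>k\<le>p. a k)"
  define w where "w = A * v / (s + A)"
  \<comment> \<open>The condition for \<open>i = 0\<close> says that the integral of
    \<open>f'\<close> is zero, so \<open>f(-1) = f(1)\<close>.\<close>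
  have "(\<Sum>k\<le>p. a k * (1 - (-1) ^ k)) = (\<Sum>k\<le>p. a k * (real k * moment (k - 1)))"
  proof (intro sum.cong refl)
    fix k show "a k * (1 - (-1) ^ k) = a k * (real k * moment (k - 1))"
      using moment_eq[of "k - 1"] by (cases k) simp_all
  qed
  also have "\<dots> = 0"
    using *[of 0] \<open>A > 0\<close> by (simp add: mult_ac sum_negf flip: sum_distrib_left)
  finally have m: "(\<Sum>k\<le>p. a k * (-1) ^ k) = v"
    by (simp add: v_def algebra_simps sum_subtractf)
  have "(\<Sum>k\<le>p. a k * moment (k + i)) = w * moment i" if "i \<le> p" for i
  proof -
    \<comment> \<open>Writing \<open>A * k\<close> as \<open>A * (k + i + 1) - A * (i + 1)\<close>
      lets \<open>moment_eq\<close> turn the first part into endpoint values.\<close>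
    have "a k * (s * (i + 1) - A * k) * moment (k + i)
        = (s + A) * (i + 1) * (a k * moment (k + i)) - A * (a k + a k * (-1) ^ k * (-1) ^ i)" for k
    proof -
      have "A * (a k + a k * (-1) ^ k * (-1) ^ i) = A * a k * (real (k + i + 1) * moment (k + i))"
        unfolding moment_eq by (simp add: algebra_simps power_add)
      then show ?thesis by (simp add: algebra_simps)
    qed
    then have "(\<Sum>k\<le>p. (s + A) * (i + 1) * (a k * moment (k + i)) - A * (a k + a k * (-1) ^ k * (-1) ^ i)) = 0"
      using *[of "i + 1"] that by simp
    then have "(s + A) * (i + 1) * (\<Sum>k\<le>p. a k * moment (k + i))
        = A * ((\<Sum>k\<le>p. a k) + (\<Sum>k\<le>p. a k * (-1) ^ k) * (-1) ^ i)"
      by (simp add: sum_subtractf sum.distrib flip: sum_distrib_left sum_distrib_right)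
    also have "\<dots> = A * v * (1 + (-1) ^ i)"
      by (simp add: m flip: v_def) (simp add: algebra_simps)
    also have "\<dots> = (s + A) * (i + 1) * (w * moment i)"
      using moment_eq[of i, symmetric] assms(1,2) by (simp add: w_def field_simps)
    finally show ?thesis
      using assms(1,2) by simp
  qed
  then have "(\<Sum>k\<le>p. (a k - (if k = 0 then w else 0)) * moment (k + i)) = 0" if "i \<le> p" for i
    using that by (simp add: left_diff_distrib sum_subtractf if_distrib[of "\<lambda>x. x * _"] cong: if_cong)
  then have a: "a k = (if k = 0 then w else 0)" if "k \<le> p" for k
    using moment_nondegenerate[of p "\<lambda>k. a k - (if k = 0 then w else 0)" k] that by simp
  \<comment> \<open>The constant \<open>w\<close> is its own value at 1, yet by definition only the
    proper fraction \<open>A / (s + A)\<close> of that value.\<close>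
  then have "v = w"
    by (simp add: v_def)
  then have "w = 0"
    using assms(1,2) by (simp add: w_def field_simps)
  with a assms(4) show ?thesis by simp
qed

section \<open>Monomials in three variables\<close>

definition monomial :: "(3 \<Rightarrow> nat) \<Rightarrow> real^3 \<Rightarrow> real" where
  "monomial e x = (\<Prod>i\<in>UNIV. x$i ^ e i)"

definition box_exps :: "nat \<Rightarrow> (3 \<Rightarrow> nat) set" where
  "box_exps p = {e. \<forall>i. e i \<le> p}"

lemma finite_box_exps [simp]: "finite (box_exps p)"
proof -
  have "box_exps p = PiE UNIV (\<lambda>_. {..p})" by (auto simp: box_exps_def PiE_def Pi_def)
  then show ?thesis by (simp add: finite_PiE)
qed

lemma UNIV_distinct_3:
  assumes "\<alpha> \<noteq> \<beta>" "\<alpha> \<noteq> \<gamma>" "\<beta> \<noteq> (\<gamma>::3)"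
  shows "UNIV = {\<alpha>, \<beta>, \<gamma>}"
proof -
  have "card {\<alpha>, \<beta>, \<gamma>} = card (UNIV :: 3 set)" using assms by simp
  then show ?thesis by (intro card_subset_eq[symmetric]) auto
qed

text \<open>Any ordering of the coordinates is allowed: 1, 2, 3 matches \<open>Qsp\<close>, the
  others bring a distinguished coordinate to the front.\<close>

lemma sum_box_exps:
  assumes "\<alpha> \<noteq> \<beta>" "\<alpha> \<noteq> \<gamma>" "\<beta> \<noteq> (\<gamma>::3)"
  shows "(\<Sum>e\<in>box_exps p. F e)
       = (\<Sum>i\<le>p. \<Sum>j\<le>p. \<Sum>k\<le>p. F (\<lambda>m. if m = \<alpha> then i else if m = \<beta> then j else k))"
proof -
  have ex: "m = \<alpha> \<or> m = \<beta> \<or> m = \<gamma>" for m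
    using UNIV_distinct_3[OF assms] by blast
  have "(\<Sum>e\<in>box_exps p. F e) = (\<Sum>(i,j,k)\<in>{..p}\<times>{..p}\<times>{..p}.
          F (\<lambda>m. if m = \<alpha> then i else if m = \<beta> then j else k))"
  proof (rule sum.reindex_bij_witness[of _ "\<lambda>(i,j,k) m. if m = \<alpha> then i else if m = \<beta> then j else k"
        "\<lambda>e. (e \<alpha>, e \<beta>, e \<gamma>)"], goal_cases)
    case (1 e)
    show ?case using ex by (auto simp: fun_eq_iff)
  next
    case (5 e)
    have "(\<lambda>m. if m = \<alpha> then e \<alpha> else if m = \<beta> then e \<beta> else e \<gamma>) = e"
      using ex by (auto simp: fun_eq_iff)
    then show ?case by simp
  qed (use assms in \<open>auto simp: box_exps_def\<close>)
  then show ?thesis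
    by (simp add: sum.cartesian_product)
qed

lemma monomial_3: "monomial e x = x$1 ^ e 1 * x$2 ^ e 2 * x$3 ^ e 3"
  unfolding monomial_def UNIV_3 by (simp add: mult.assoc)

lemma Qsp_iff: "f \<in> Qsp p \<longleftrightarrow> (\<exists>c. \<forall>x. f x = (\<Sum>e\<in>box_exps p. c e * monomial e x))"
proof
  assume "f \<in> Qsp p"
  then obtain c where "\<And>x. f x = (\<Sum>i\<le>p. \<Sum>j\<le>p. \<Sum>k\<le>p. c i j k * (x$1)^i * (x$2)^j * (x$3)^k)"
    unfolding Qsp_def by blast
  then show "\<exists>c. \<forall>x. f x = (\<Sum>e\<in>box_exps p. c e * monomial e x)"
    by (intro exI[of _ "\<lambda>e. c (e 1) (e 2) (e 3)"])
       (simp add: sum_box_exps[of 1 2 3] monomial_3 mult.assoc)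
next
  assume "\<exists>c. \<forall>x. f x = (\<Sum>e\<in>box_exps p. c e * monomial e x)"
  then obtain c where "\<And>x. f x = (\<Sum>e\<in>box_exps p. c e * monomial e x)" by blast
  then show "f \<in> Qsp p"
    unfolding Qsp_def mem_Collect_eq
    by (intro exI[of _ "\<lambda>i j k. c (\<lambda>m. if m = 1 then i else if m = 2 then j else k)"])
       (simp add: sum_box_exps[of 1 2 3] monomial_3 mult.assoc)
qed

lemma Qsp_E:
  assumes "f \<in> Qsp p"
  obtains c where "f = (\<lambda>x. \<Sum>e\<in>box_exps p. c e * monomial e x)"
  using assms unfolding Qsp_iff by blast

lemma monomial_in_Qsp: "e \<in> box_exps p \<Longrightarrow> monomial e \<in> Qsp p"
  unfolding Qsp_iff
  by (intro exI[of _ "\<lambda>d. if d = e then 1 else 0"]) (simp add: if_distrib[of "\<lambda>x. x * _"] cong: if_cong)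

lemma Qsp_mono:
  assumes "r \<le> p"
  shows "Qsp r \<subseteq> Qsp p"
proof
  fix f assume "f \<in> Qsp r"
  then obtain c where c: "\<And>x. f x = (\<Sum>e\<in>box_exps r. c e * monomial e x)" unfolding Qsp_iff by blast
  have sub: "box_exps r \<subseteq> box_exps p" using assms by (auto simp: box_exps_def intro: order.trans)
  have "f x = (\<Sum>e\<in>box_exps p. (if e \<in> box_exps r then c e else 0) * monomial e x)" for x
    unfolding c by (intro sum.mono_neutral_cong_left sub) auto
  then show "f \<in> Qsp p"
    unfolding Qsp_iff by (intro exI[of _ "\<lambda>e. if e \<in> box_exps r then c e else 0"]) simp
qed

section \<open>Integral, tensor rule and defect on monomials\<close>

lemma continuous_on_monomial [continuous_intros]: "continuous_on S (monomial e)"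
  unfolding monomial_def[abs_def] by (intro continuous_intros)

text \<open>Fubini for products of one-variable functions. Lebesgue measure on
  \<open>real^'n\<close> is a product over \<open>Basis\<close>, so the indices are carried along
  \<open>i \<mapsto> axis i 1\<close>, with inverse \<open>ix\<close>.\<close>

lemma integral_prod_components:
  fixes g :: "'n::finite \<Rightarrow> real \<Rightarrow> real"
  assumes "\<And>i. integrable lborel (g i)"
  shows "(\<integral>x. (\<Prod>i\<in>UNIV. g i (x$i)) \<partial>(lborel::(real^'n) measure)) = (\<Prod>i\<in>UNIV. \<integral>t. g i t \<partial>lborel)"
proof -
  interpret product_sigma_finite "\<lambda>b::real^'n. lborel :: real measure" ..
  define ix where "ix b = (THE i. axis i (1::real) = (b::real^'n))" for b
  have ix: "ix (axis i 1) = i" for i unfolding ix_def by (auto simp: axis_eq_axis)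
  have bij: "bij_betw (\<lambda>i. axis i (1::real)) (UNIV::'n set) Basis"
    by (auto simp: bij_betw_def inj_on_def axis_eq_axis Basis_vec_def)
  have [measurable]: "g i \<in> borel_measurable borel" for i
    using borel_measurable_integrable[OF assms] by simp
  have P: "(\<Prod>i\<in>UNIV. g i (x$i)) = (\<Prod>b\<in>Basis. g (ix b) (x \<bullet> b))" for x :: "real^'n"
    using prod.reindex_bij_betw[OF bij, of "\<lambda>b. g (ix b) (x \<bullet> b)"]
    by (simp add: ix cart_eq_inner_axis)
  have "(\<integral>x. (\<Prod>i\<in>UNIV. g i (x$i)) \<partial>(lborel::(real^'n) measure))
      = (\<integral>f. (\<Prod>b\<in>Basis. g (ix b) ((\<Sum>b\<in>(Basis::(real^'n) set). f b *\<^sub>R b) \<bullet> b)) \<partial>(\<Pi>\<^sub>M b\<in>Basis. lborel))"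
    unfolding P by (subst lborel_eq) (subst integral_distr; measurable)
  also have "\<dots> = (\<integral>f. (\<Prod>b\<in>Basis. g (ix b) (f b)) \<partial>(\<Pi>\<^sub>M b\<in>(Basis::(real^'n) set). lborel))"
    by (intro Bochner_Integration.integral_cong refl prod.cong) (simp add: inner_sum_left_Basis)
  also have "\<dots> = (\<Prod>b\<in>(Basis::(real^'n) set). \<integral>t. g (ix b) t \<partial>lborel)"
    by (intro product_integral_prod assms) simp
  also have "\<dots> = (\<Prod>i\<in>UNIV. \<integral>t. g i t \<partial>lborel)"
    using prod.reindex_bij_betw[OF bij, of "\<lambda>b. \<integral>t. g (ix b) t \<partial>lborel"]
    by (simp add: ix)
  finally show ?thesis .
qed

text \<open>The indicator of the cube is the product of the indicators of its edges, which brings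
  the integral into the form of \<open>integral_prod_components\<close>.\<close>

lemma integral_monomial: "integral (cbox (-1) 1) (monomial e) = (\<Prod>i\<in>UNIV. moment (e i))"
proof -
  let ?g = "\<lambda>k t. indicator {-1..1} t * t ^ k :: real"
  have int: "integrable lborel (?g k)" for k
    using borel_integrable_compact[of "{-1..1}" "\<lambda>t::real. t ^ k"]
    by (simp add: continuous_on_power)
  then have moment: "moment k = (\<integral>t. ?g k t \<partial>lborel)" for k
    using set_borel_integral_eq_integral(2)[of "{-1..1}" "\<lambda>t::real. t ^ k"]
    by (simp add: moment_def pint_def poly_monom[abs_def] set_integrable_def set_lebesgue_integral_def)
  have "indicator (cbox (-1) 1) x = (\<Prod>i\<in>UNIV. indicator {-1..1} (x$i) :: real)" for x :: "real^3"
    by (auto simp: mem_box_cart indicator_def)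
  then have ind: "indicator (cbox (-1) 1) x * monomial e x = (\<Prod>i\<in>UNIV. ?g (e i) (x$i))" for x
    by (simp add: monomial_def prod.distrib)
  have "integrable lborel (\<lambda>x. indicator (cbox (-1) 1) x *\<^sub>R monomial e x)"
    by (intro borel_integrable_compact continuous_intros compact_cbox)
  then have "integral (cbox (-1) 1) (monomial e) = (\<integral>x. (\<Prod>i\<in>UNIV. ?g (e i) (x$i)) \<partial>lborel)"
    using set_borel_integral_eq_integral(2)[of "cbox (-1) 1" "monomial e"]
    by (simp add: set_integrable_def set_lebesgue_integral_def ind)
  also have "\<dots> = (\<Prod>i\<in>UNIV. moment (e i))"
    unfolding moment by (intro integral_prod_components int)
  finally show ?thesis .
qed

definition tdefect :: "nat \<Rightarrow> (real^3 \<Rightarrow> real) \<Rightarrow> real" where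
  "tdefect n F = tensor_gauss n F - integral (cbox (-1) 1) F"

definition gmoment :: "nat \<Rightarrow> nat \<Rightarrow> real" where
  "gmoment n k = gauss n (monom 1 k)"

lemma tensor_gauss_monomial: "tensor_gauss n (monomial e) = (\<Prod>i\<in>UNIV. gmoment n (e i))"
proof -
  have "tensor_gauss n (monomial e) = (\<Sum>a\<in>gauss_nodes n. \<Sum>b\<in>gauss_nodes n. \<Sum>c\<in>gauss_nodes n.
      (gauss_weight n a * a ^ e 1) * ((gauss_weight n b * b ^ e 2) * (gauss_weight n c * c ^ e 3)))"
    unfolding tensor_gauss_def monomial_3 by (intro sum.cong refl) (simp add: mult_ac)
  also have "\<dots> = gmoment n (e 1) * (gmoment n (e 2) * gmoment n (e 3))"
    unfolding sum_distrib_left[symmetric] sum_distrib_right[symmetric]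
    by (simp add: gmoment_def gauss_def poly_monom)
  also have "\<dots> = (\<Prod>i\<in>UNIV. gmoment n (e i))"
    unfolding UNIV_3 by simp
  finally show ?thesis .
qed

definition monomial_defect :: "nat \<Rightarrow> (3 \<Rightarrow> nat) \<Rightarrow> real" where
  "monomial_defect n e = (\<Prod>i\<in>UNIV. gmoment n (e i)) - (\<Prod>i\<in>UNIV. moment (e i))"

lemma tdefect_monomial: "tdefect n (monomial e) = monomial_defect n e"
  by (simp add: tdefect_def tensor_gauss_monomial integral_monomial monomial_defect_def)

lemma tdefect_add:
  assumes "continuous_on UNIV F" "continuous_on UNIV G"
  shows "tdefect n (\<lambda>x. F x + G x) = tdefect n F + tdefect n G"
proof -
  have "F integrable_on cbox (-1) 1" "G integrable_on cbox (-1) 1"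
    using assms by (auto intro!: integrable_continuous intro: continuous_on_subset)
  then show ?thesis
    by (simp add: tdefect_def tensor_gauss_def integral_add sum.distrib algebra_simps)
qed

lemma tdefect_cmult: "tdefect n (\<lambda>x. c * F x) = c * tdefect n F"
  by (simp add: tdefect_def tensor_gauss_def sum_distrib_left algebra_simps)

lemma tdefect_0: "tdefect n (\<lambda>x. 0) = 0"
  using tdefect_cmult[of n 0 "\<lambda>_. 0"] by simp

lemma tdefect_sum:
  assumes "\<And>i. i \<in> I \<Longrightarrow> continuous_on UNIV (F i)"
  shows "tdefect n (\<lambda>x. \<Sum>i\<in>I. F i x) = (\<Sum>i\<in>I. tdefect n (F i))"
  using assms
proof (induction I rule: infinite_finite_induct)
  case (insert i I)
  then show ?case by (simp add: tdefect_add continuous_on_sum)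
qed (simp_all add: tdefect_0)

lemma gmoment_exact: "k < 2 * n \<Longrightarrow> gmoment n k = moment k"
  by (simp add: gmoment_def moment_def gauss_exact degree_monom_eq)

lemma monomial_defect_exact: "(\<And>i. e i < 2 * n) \<Longrightarrow> monomial_defect n e = 0"
  by (simp add: monomial_defect_def gmoment_exact)

section \<open>Polarized determinants of gradients\<close>

definition det3 :: "real^3 \<Rightarrow> real^3 \<Rightarrow> real^3 \<Rightarrow> real" where
  "det3 a b c = a$1 * (b$2 * c$3 - b$3 * c$2) - a$2 * (b$1 * c$3 - b$3 * c$1)
              + a$3 * (b$1 * c$2 - b$2 * c$1)"

text \<open>Both sides are symmetric trilinear forms equal to \<open>6 * det A\<close> on the
  diagonal. The right side runs over the signed permutations of the row indices and so separates the
  components of the three fields.\<close>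

lemma frobenius_mat_cross:
  "frobenius A (mat_cross B C)
     = det3 (A$1) (B$2) (C$3) - det3 (A$1) (B$3) (C$2)
     + det3 (A$2) (B$3) (C$1) - det3 (A$2) (B$1) (C$3)
     + det3 (A$3) (B$1) (C$2) - det3 (A$3) (B$2) (C$1)"
  by (simp add: frobenius_def mat_cross_def cof_def trace_def sum_3 transpose_def
      matrix_matrix_mult_def det3_def) (simp add: algebra_simps)

lemma det3_sum_left: "det3 (\<Sum>i\<in>I. f i) b c = (\<Sum>i\<in>I. det3 (f i) b c)"
  by (simp add: det3_def sum_distrib_right sum.distrib sum_subtractf)

lemma det3_sum_mid: "det3 a (\<Sum>i\<in>I. f i) c = (\<Sum>i\<in>I. det3 a (f i) c)"
  by (simp add: det3_def sum_distrib_left sum_distrib_right sum.distrib sum_subtractf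
      left_diff_distrib right_diff_distrib mult.assoc)

lemma det3_sum_right: "det3 a b (\<Sum>i\<in>I. f i) = (\<Sum>i\<in>I. det3 a b (f i))"
  by (simp add: det3_def sum_distrib_left sum_distrib_right sum.distrib sum_subtractf
      left_diff_distrib right_diff_distrib mult.assoc)

lemma det3_scaleR:
  "det3 (r *\<^sub>R a) b c = r * det3 a b c" "det3 a (r *\<^sub>R b) c = r * det3 a b c"
  "det3 a b (r *\<^sub>R c) = r * det3 a b c"
  by (simp_all add: det3_def algebra_simps)

lemma det3_0: "det3 0 b c = 0" "det3 a 0 c = 0" "det3 a b 0 = 0"
  by (simp_all add: det3_def)

section \<open>Gradients of polynomials\<close>

definition grad :: "(real^3 \<Rightarrow> real) \<Rightarrow> real^3 \<Rightarrow> real^3" where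
  "grad f x = (\<chi> j. frechet_derivative f (at x) (axis j 1))"

lemma grad_eqI: "(f has_derivative (\<lambda>h. v \<bullet> h)) (at x) \<Longrightarrow> grad f x = v"
  using frechet_derivative_at[of f "\<lambda>h. v \<bullet> h" x]
  by (simp add: grad_def vec_eq_iff inner_axis flip: frechet_derivative_at)

lemma jacobian_row:
  assumes "z differentiable at x"
  shows "jacobian z (at x) $ i = grad (\<lambda>x. z x $ i) x"
proof -
  have "(z has_derivative frechet_derivative z (at x)) (at x)"
    using assms by (simp add: frechet_derivative_works)
  then have "((\<lambda>x. z x $ i) has_derivative (\<lambda>h. frechet_derivative z (at x) h $ i)) (at x)"
    by (rule bounded_linear.has_derivative[OF bounded_linear_vec_nth])
  from fun_cong[OF frechet_derivative_at[OF this]] show ?thesis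
    by (simp add: jacobian_def matrix_def grad_def vec_eq_iff)
qed

text \<open>For \<open>e i = 0\<close> the truncated exponent is harmless, because the factor
  \<open>e i\<close> vanishes.\<close>

definition monomial_grad :: "(3 \<Rightarrow> nat) \<Rightarrow> real^3 \<Rightarrow> real^3" where
  "monomial_grad e x = (\<chi> i. e i * monomial (e(i := e i - 1)) x)"

lemma monomial_has_derivative:
  "(monomial e has_derivative (\<lambda>h. monomial_grad e x \<bullet> h)) (at x)"
proof -
  have [derivative_intros]: "((\<lambda>x::real^3. x$i) has_derivative (\<lambda>h. h$i)) (at x)" for i
    by (rule bounded_linear_imp_has_derivative[OF bounded_linear_vec_nth])
  show ?thesis
    unfolding monomial_3[abs_def]
    by (rule has_derivative_eq_rhs, (rule derivative_intros)+)
       (simp add: fun_eq_iff inner_vec_def sum_3 monomial_grad_def monomial_3 algebra_simps)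
qed

lemma polynomial_has_derivative:
  "((\<lambda>x. \<Sum>e\<in>E. c e * monomial e x) has_derivative
     (\<lambda>h. (\<Sum>e\<in>E. c e *\<^sub>R monomial_grad e x) \<bullet> h)) (at x)"
  by (rule has_derivative_eq_rhs,
      rule has_derivative_sum[OF has_derivative_mult_right[OF monomial_has_derivative]])
     (simp add: inner_sum_left)

lemma grad_polynomial:
  "grad (\<lambda>x. \<Sum>e\<in>E. c e * monomial e x) x = (\<Sum>e\<in>E. c e *\<^sub>R monomial_grad e x)"
  by (rule grad_eqI[OF polynomial_has_derivative])

lemma Qsp_differentiable:
  assumes "f \<in> Qsp p"
  shows "f differentiable at x"
proof -
  obtain c where "f = (\<lambda>x. \<Sum>e\<in>box_exps p. c e * monomial e x)"
    using assms by (rule Qsp_E)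
  then show ?thesis
    using polynomial_has_derivative unfolding differentiable_def by blast
qed

lemma Qvec_differentiable:
  assumes "z \<in> Qvec p"
  shows "z differentiable at x"
proof -
  have "((\<lambda>x. z x $ i) has_derivative frechet_derivative (\<lambda>x. z x $ i) (at x)) (at x)" for i
    using assms Qsp_differentiable by (auto simp: Qvec_def simp flip: frechet_derivative_works)
  then have "(z has_derivative (\<lambda>h. \<chi> i. frechet_derivative (\<lambda>x. z x $ i) (at x) h)) (at x)"
    unfolding has_derivative_componentwise_within[of z]
    by (auto simp: Basis_vec_def inner_axis)
  then show ?thesis unfolding differentiable_def by blast
qed

definition exp_vec :: "(3 \<Rightarrow> nat) \<Rightarrow> real^3" where
  "exp_vec e = (\<chi> i. real (e i))"

text \<open>Each of the six products differentiates once in every coordinate, so all carry the same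
  monomial and only the exponents enter the determinant. If a coordinate is absent from all three
  monomials, that determinant has a zero column, which makes the truncated \<open>- 1\<close>
  harmless.\<close>

lemma det3_monomial_grad:
  "det3 (monomial_grad e x) (monomial_grad g x) (monomial_grad h x)
     = det3 (exp_vec e) (exp_vec g) (exp_vec h) * monomial (\<lambda>i. e i + g i + h i - 1) x"
proof -
  have P: "real a * X ^ (a - 1) * X ^ b * X ^ c = real a * X ^ (a + b + c - 1)"
    for a b c and X :: real
    by (cases a) (simp_all add: power_add)
  have entry: "(monomial_grad e x $ i * (monomial_grad g x $ j * monomial_grad h x $ k))
     = exp_vec e $ i * (exp_vec g $ j * exp_vec h $ k) * monomial (\<lambda>i. e i + g i + h i - 1) x"
    if "{i, j, k} = UNIV" "i \<noteq> j" "i \<noteq> k" "j \<noteq> k" for i j k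
  proof -
    have U: "(\<Prod>m\<in>UNIV. F m) = F i * F j * F k" for F :: "3 \<Rightarrow> real"
      using that(2-4) by (simp add: mult.assoc flip: that(1))
    have "monomial_grad e x $ i * (monomial_grad g x $ j * monomial_grad h x $ k)
      = (e i * x$i ^ (e i - 1) * x$i ^ g i * x$i ^ h i)
      * (g j * x$j ^ (g j - 1) * x$j ^ e j * x$j ^ h j)
      * (h k * x$k ^ (h k - 1) * x$k ^ e k * x$k ^ g k)"
      using that(2-4) by (simp add: monomial_grad_def monomial_def U mult_ac)
    also have "\<dots> = exp_vec e $ i * (exp_vec g $ j * exp_vec h $ k)
        * monomial (\<lambda>i. e i + g i + h i - 1) x"
      unfolding P by (simp add: exp_vec_def monomial_def U add_ac mult_ac)
    finally show ?thesis .
  qed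
  have "{1, 2, 3} = (UNIV::3 set)" "{1, 3, 2} = (UNIV::3 set)" "{2, 1, 3} = (UNIV::3 set)"
    "{2, 3, 1} = (UNIV::3 set)" "{3, 1, 2} = (UNIV::3 set)" "{3, 2, 1} = (UNIV::3 set)"
    by (auto simp: UNIV_3)
  note entry[OF this(1)] entry[OF this(2)] entry[OF this(3)] entry[OF this(4)] entry[OF this(5)] entry[OF this(6)]
  then show ?thesis
    by (simp add: det3_def right_diff_distrib) (simp add: algebra_simps)
qed

section \<open>The scalar determinant defect\<close>

definition det_defect ::
  "nat \<Rightarrow> (real^3 \<Rightarrow> real) \<Rightarrow> (real^3 \<Rightarrow> real) \<Rightarrow> (real^3 \<Rightarrow> real) \<Rightarrow> real" where
  "det_defect n f g h = tdefect n (\<lambda>x. det3 (grad f x) (grad g x) (grad h x))"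

lemma det3_grad_polynomials:
  "det3 (grad (\<lambda>x. \<Sum>e\<in>E. a e * monomial e x) x)
        (grad (\<lambda>x. \<Sum>e\<in>F. b e * monomial e x) x) (grad (\<lambda>x. \<Sum>e\<in>G. c e * monomial e x) x)
   = (\<Sum>e\<in>E. \<Sum>g\<in>F. \<Sum>h\<in>G. (a e * b g * c h * det3 (exp_vec e) (exp_vec g) (exp_vec h))
        * monomial (\<lambda>i. e i + g i + h i - 1) x)"
  unfolding grad_polynomial unfolding det3_sum_left unfolding det3_sum_mid unfolding det3_sum_right
  by (intro sum.cong refl) (simp add: det3_scaleR det3_monomial_grad)

lemma det_defect_polynomials:
  "det_defect n (\<lambda>x. \<Sum>e\<in>E. a e * monomial e x)
        (\<lambda>x. \<Sum>e\<in>F. b e * monomial e x) (\<lambda>x. \<Sum>e\<in>G. c e * monomial e x)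
   = (\<Sum>e\<in>E. \<Sum>g\<in>F. \<Sum>h\<in>G. (a e * b g * c h * det3 (exp_vec e) (exp_vec g) (exp_vec h))
        * monomial_defect n (\<lambda>i. e i + g i + h i - 1))"
  unfolding det_defect_def det3_grad_polynomials
  by (simp add: tdefect_sum continuous_on_sum continuous_on_mult_left continuous_on_monomial
      tdefect_cmult tdefect_monomial)

text \<open>Every coordinate loses one degree to differentiation, so all exponents stay below
  \<open>2 * n\<close>; \<open>0 < n\<close> covers the truncated exponent 0.\<close>

lemma det_defect_exact:
  assumes "f \<in> Qsp r" "g \<in> Qsp p" "h \<in> Qsp p" "r + 2 * p \<le> 2 * n" "0 < n"
  shows "det_defect n f g h = 0"
proof -
  obtain a b c where eq: "f = (\<lambda>x. \<Sum>e\<in>box_exps r. a e * monomial e x)"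
      "g = (\<lambda>x. \<Sum>e\<in>box_exps p. b e * monomial e x)" "h = (\<lambda>x. \<Sum>e\<in>box_exps p. c e * monomial e x)"
    using assms(1-3) by (blast elim: Qsp_E)
  have "monomial_defect n (\<lambda>i. e i + g i + h i - 1) = 0"
    if "e \<in> box_exps r" "g \<in> box_exps p" "h \<in> box_exps p" for e g h
  proof (rule monomial_defect_exact)
    fix i
    have "e i \<le> r" "g i \<le> p" "h i \<le> p" using that by (auto simp: box_exps_def)
    then show "e i + g i + h i - 1 < 2 * n" using assms(4,5) by linarith
  qed
  then show ?thesis
    unfolding eq det_defect_polynomials by (intro sum.neutral ballI) simp
qed

lemma continuous_det3_grad:
  assumes "f \<in> Qsp p" "g \<in> Qsp p" "h \<in> Qsp p"
  shows "continuous_on UNIV (\<lambda>x. det3 (grad f x) (grad g x) (grad h x))"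
proof -
  obtain a b c where eq: "f = (\<lambda>x. \<Sum>e\<in>box_exps p. a e * monomial e x)"
      "g = (\<lambda>x. \<Sum>e\<in>box_exps p. b e * monomial e x)" "h = (\<lambda>x. \<Sum>e\<in>box_exps p. c e * monomial e x)"
    using assms(1-3) by (blast elim: Qsp_E)
  show ?thesis
    unfolding eq det3_grad_polynomials by (intro continuous_intros)
qed

lemma tdefect_diff:
  assumes "continuous_on UNIV F" "continuous_on UNIV G"
  shows "tdefect n (\<lambda>x. F x - G x) = tdefect n F - tdefect n G"
  using tdefect_add[OF assms(1), of "\<lambda>x. (-1) * G x"] tdefect_cmult[of n "-1" G] assms
  by (simp add: continuous_on_minus)

lemma defect_eq:
  assumes "z \<in> Qvec p" "u \<in> Qvec p" "v \<in> Qvec p"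
  shows "defect n z u v
     = det_defect n (\<lambda>x. z x $ 1) (\<lambda>x. u x $ 2) (\<lambda>x. v x $ 3)
     - det_defect n (\<lambda>x. z x $ 1) (\<lambda>x. u x $ 3) (\<lambda>x. v x $ 2)
     + det_defect n (\<lambda>x. z x $ 2) (\<lambda>x. u x $ 3) (\<lambda>x. v x $ 1)
     - det_defect n (\<lambda>x. z x $ 2) (\<lambda>x. u x $ 1) (\<lambda>x. v x $ 3)
     + det_defect n (\<lambda>x. z x $ 3) (\<lambda>x. u x $ 1) (\<lambda>x. v x $ 2)
     - det_defect n (\<lambda>x. z x $ 3) (\<lambda>x. u x $ 2) (\<lambda>x. v x $ 1)"
proof -
  have cont: "continuous_on UNIV (\<lambda>x. det3 (grad (\<lambda>x. z x $ i) x) (grad (\<lambda>x. u x $ j) x)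
      (grad (\<lambda>x. v x $ k) x))" for i j k
    using assms by (intro continuous_det3_grad[of _ p]) (auto simp: Qvec_def)
  have "defect n z u v = tdefect n (\<lambda>x. frobenius (jacobian z (at x))
      (mat_cross (jacobian u (at x)) (jacobian v (at x))))"
    by (simp add: defect_def tdefect_def Let_def)
  also have "\<dots> = tdefect n (\<lambda>x.
       det3 (grad (\<lambda>x. z x $ 1) x) (grad (\<lambda>x. u x $ 2) x) (grad (\<lambda>x. v x $ 3) x)
     - det3 (grad (\<lambda>x. z x $ 1) x) (grad (\<lambda>x. u x $ 3) x) (grad (\<lambda>x. v x $ 2) x)
     + det3 (grad (\<lambda>x. z x $ 2) x) (grad (\<lambda>x. u x $ 3) x) (grad (\<lambda>x. v x $ 1) x)
     - det3 (grad (\<lambda>x. z x $ 2) x) (grad (\<lambda>x. u x $ 1) x) (grad (\<lambda>x. v x $ 3) x)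
     + det3 (grad (\<lambda>x. z x $ 3) x) (grad (\<lambda>x. u x $ 1) x) (grad (\<lambda>x. v x $ 2) x)
     - det3 (grad (\<lambda>x. z x $ 3) x) (grad (\<lambda>x. u x $ 2) x) (grad (\<lambda>x. v x $ 1) x))"
    by (simp add: frobenius_mat_cross jacobian_row Qvec_differentiable[OF assms(1)]
        Qvec_differentiable[OF assms(2)] Qvec_differentiable[OF assms(3)])
  finally show ?thesis
    by (simp add: tdefect_add tdefect_diff continuous_on_add continuous_on_diff
        cont det_defect_def)
qed

section \<open>Detecting high degree coefficients\<close>

lemma det_defect_monomials:
  "det_defect n (\<lambda>x. \<Sum>e\<in>E. a e * monomial e x) (monomial g) (monomial h)
   = (\<Sum>e\<in>E. a e * det3 (exp_vec e) (exp_vec g) (exp_vec h)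
        * monomial_defect n (\<lambda>i. e i + g i + h i - 1))"
  using det_defect_polynomials[of n a E "\<lambda>_. 1" "{g}" "\<lambda>_. 1" "{h}"] by simp

text \<open>By multilinearity the terms \<open>det3 e g h\<close> cancel, and alternation leaves
  \<open>det3 e (axis \<beta> 1) (g + h)\<close>, a 2 by 2 minor up to the sign of the ordering
  \<open>\<alpha>, \<beta>, \<gamma>\<close>.\<close>

lemma det3_transfer:
  fixes \<alpha> \<beta> \<gamma> :: 3
  assumes "\<alpha> \<noteq> \<beta>" "\<alpha> \<noteq> \<gamma>" "\<beta> \<noteq> \<gamma>"
  obtains \<epsilon> :: real where "\<epsilon> \<noteq> 0"
    "\<And>e g h. det3 e (axis \<beta> 1 + g) h - det3 e g (axis \<beta> 1 + h)
       = \<epsilon> * (e$\<alpha> * (g$\<gamma> + h$\<gamma>) - e$\<gamma> * (g$\<alpha> + h$\<alpha>))"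
proof -
  let ?\<epsilon> = "det3 (axis \<alpha> 1) (axis \<beta> 1) (axis \<gamma> 1)"
  have 1: "det3 e (axis \<beta> 1) k = ?\<epsilon> * (e$\<alpha> * k$\<gamma> - e$\<gamma> * k$\<alpha>)" for e k
    using assms exhaust_3[of \<alpha>] exhaust_3[of \<beta>] exhaust_3[of \<gamma>]
    by (elim disjE; simp add: det3_def axis_def)
  have 2: "det3 e (axis \<beta> 1 + g) h - det3 e g (axis \<beta> 1 + h) = det3 e (axis \<beta> 1) (g + h)" for e g h
    by (simp add: det3_def algebra_simps)
  have 3: "?\<epsilon> \<noteq> 0"
    using assms exhaust_3[of \<alpha>] exhaust_3[of \<beta>] exhaust_3[of \<gamma>]
    by (elim disjE; simp add: det3_def axis_def)
  show ?thesis
    by (rule that[OF 3], unfold 2, subst 1) simp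
qed

text \<open>
  Moving a factor \<open>x\<^sub>\<beta>\<close> from \<open>H\<close> to \<open>G\<close> changes \<open>det (\<nabla>f, \<nabla>G, \<nabla>(x\<^sub>\<beta> H))\<close> into
  \<open>det (\<nabla>f, \<nabla>(x\<^sub>\<beta> G), \<nabla>H)\<close>, and the difference is the plane Jacobian of \<open>f\<close> and the product
  \<open>G * H\<close> in the variables \<open>x\<^sub>\<alpha>, x\<^sub>\<gamma>\<close>. Here \<open>d\<close> is the exponent of \<open>G * H\<close>.
\<close>

lemma jacobian_moment_condition:
  fixes \<alpha> \<beta> \<gamma> :: 3
  assumes ne: "\<alpha> \<noteq> \<beta>" "\<alpha> \<noteq> \<gamma>" "\<beta> \<noteq> \<gamma>"
    and zero: "\<And>g h. g \<in> box_exps p \<Longrightarrow> h \<in> box_exps p \<Longrightarrow>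
      det_defect n (\<lambda>x. \<Sum>e\<in>E. c e * monomial e x) (monomial g) (monomial h) = 0"
    and d: "d \<alpha> \<le> 2 * p" "d \<beta> + 2 \<le> 2 * p" "d \<gamma> \<le> 2 * p"
  shows "(\<Sum>e\<in>E. c e * (real (e \<alpha>) * real (d \<gamma>) - real (e \<gamma>) * real (d \<alpha>))
           * monomial_defect n (\<lambda>i. if i = \<beta> then e i + d i else e i + d i - 1)) = 0"
proof -
  obtain \<epsilon> :: real where \<epsilon>: "\<epsilon> \<noteq> 0"
    "\<And>e g h. det3 e (axis \<beta> 1 + g) h - det3 e g (axis \<beta> 1 + h)
       = \<epsilon> * (e$\<alpha> * (g$\<gamma> + h$\<gamma>) - e$\<gamma> * (g$\<alpha> + h$\<alpha>))"
    using det3_transfer[OF ne] by blast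
  have ex: "m = \<alpha> \<or> m = \<beta> \<or> m = \<gamma>" for m
    using UNIV_distinct_3[OF ne] by blast
  \<comment> \<open>Splitting \<open>d\<close> evenly keeps both factors within degree
    \<open>p\<close>; \<open>d \<beta> + 2 \<le> 2 * p\<close> leaves either one room for the
    additional \<open>x$\<beta>\<close>.\<close>
  define g where "g i = d i div 2" for i
  define h where "h i = d i - d i div 2" for i
  have gh: "g i + h i = d i" for i by (simp add: g_def h_def)
  define up where "up e = e(\<beta> := e \<beta> + 1)" for e :: "3 \<Rightarrow> nat"
  have up: "exp_vec (up e) = axis \<beta> 1 + exp_vec e" for e
    by (simp add: exp_vec_def up_def vec_eq_iff axis_def)
  have bound: "g \<in> box_exps p" "h \<in> box_exps p" "up g \<in> box_exps p" "up h \<in> box_exps p"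
  proof -
    have le: "d i \<le> 2 * p" for i using ex[of i] d by auto
    have "g i \<le> p" for i using le[of i] by (simp add: g_def)
    moreover have "h i \<le> p" for i using le[of i] by (simp add: h_def)
    moreover have "g \<beta> + 1 \<le> p" "h \<beta> + 1 \<le> p" using d(2) by (simp_all add: g_def h_def)
    ultimately show "g \<in> box_exps p" "h \<in> box_exps p" "up g \<in> box_exps p" "up h \<in> box_exps p"
      by (auto simp: box_exps_def up_def)
  qed
  let ?D = "\<lambda>e. monomial_defect n (\<lambda>i. if i = \<beta> then e i + d i else e i + d i - 1)"
  \<comment> \<open>The added factor makes up for the derivative in \<open>x$\<beta>\<close>, hence
    no \<open>- 1\<close> there.\<close>
  have exps: "(\<lambda>i. e i + up g i + h i - 1) = (\<lambda>i. if i = \<beta> then e i + d i else e i + d i - 1)"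
    "(\<lambda>i. e i + g i + up h i - 1) = (\<lambda>i. if i = \<beta> then e i + d i else e i + d i - 1)" for e
    by (auto simp: up_def fun_eq_iff add.assoc simp flip: gh)
  have "0 = det_defect n (\<lambda>x. \<Sum>e\<in>E. c e * monomial e x) (monomial (up g)) (monomial h)
     - det_defect n (\<lambda>x. \<Sum>e\<in>E. c e * monomial e x) (monomial g) (monomial (up h))"
    using zero bound by simp
  also have "\<dots> = (\<Sum>e\<in>E. c e * (det3 (exp_vec e) (axis \<beta> 1 + exp_vec g) (exp_vec h)
      - det3 (exp_vec e) (exp_vec g) (axis \<beta> 1 + exp_vec h)) * ?D e)"
    unfolding det_defect_monomials exps up by (simp add: algebra_simps sum_subtractf)
  also have "\<dots> = (\<Sum>e\<in>E. \<epsilon> * (c e * (real (e \<alpha>) * real (d \<gamma>) - real (e \<gamma>) * real (d \<alpha>)) * ?D e))"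
    unfolding \<epsilon>(2) by (intro sum.cong refl) (simp add: exp_vec_def mult_ac flip: of_nat_add gh)
  finally show ?thesis
    using \<epsilon>(1) by (simp flip: sum_distrib_left)
qed

text \<open>The conditions isolate only the top coefficient in \<open>x$\<alpha>\<close>. The
  argument therefore runs by contradiction through the largest surviving exponent \<open>s\<close>,
  which also exceeds \<open>2 * (n - p)\<close>.\<close>

lemma coefficients_vanish:
  assumes np: "p + 1 \<le> n" and p: "3 \<le> p"
    and zero: "\<And>g h. g \<in> box_exps p \<Longrightarrow> h \<in> box_exps p \<Longrightarrow>
      det_defect n (\<lambda>x. \<Sum>e\<in>box_exps p. c e * monomial e x) (monomial g) (monomial h) = 0"
    and e: "e \<in> box_exps p" and large: "e \<alpha> > 2 * (n - p)"
  shows "c e = 0"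
proof (rule ccontr)
  assume ce: "c e \<noteq> 0"
  define S where "S = {e \<alpha> | e. e \<in> box_exps p \<and> c e \<noteq> 0}"
  define s where "s = Max S"
  have "finite S" by (simp add: S_def)
  have "e \<alpha> \<in> S" using e ce by (auto simp: S_def)
  then have "s \<in> S" "e \<alpha> \<le> s"
    unfolding s_def using \<open>finite S\<close> Max_in[of S] Max_ge[of S] by blast+
  then obtain e' where e': "e' \<in> box_exps p" "c e' \<noteq> 0" "e' \<alpha> = s" by (auto simp: S_def)
  have s: "s > 2 * (n - p)" "s \<le> p" using \<open>e \<alpha> \<le> s\<close> large e' by (auto simp: box_exps_def)
  have s_max: "c e = 0" if "e \<in> box_exps p" "e \<alpha> > s" for e
  proof (rule ccontr)
    assume "c e \<noteq> 0"
    then have "e \<alpha> \<in> S" using that by (auto simp: S_def)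
    then have "e \<alpha> \<le> s" using Max_ge[OF \<open>finite S\<close>] by (simp add: s_def)
    then show False using that by simp
  qed
  obtain \<beta> \<gamma> where ne: "\<alpha> \<noteq> \<beta>" "\<alpha> \<noteq> \<gamma>" "\<beta> \<noteq> \<gamma>"
  proof -
    consider "\<alpha> = 1" | "\<alpha> = 2" | "\<alpha> = 3" using exhaust_3 by blast
    then show thesis
      by cases (rule that[of 2 3] that[of 1 3] that[of 1 2]; simp)+
  qed
  let ?e = "\<lambda>i j k m. if m = \<alpha> then i else if m = \<beta> then j else k :: nat"
  note UNIV_eq = UNIV_distinct_3[OF ne]
  have U: "(\<Prod>m\<in>UNIV. F m) = F \<alpha> * F \<beta> * F \<gamma>" for F :: "3 \<Rightarrow> real"
    unfolding UNIV_eq using ne by (simp add: mult.assoc)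
  \<comment> \<open>After one differentiation the exponent of \<open>x$\<alpha>\<close> is
    \<open>2 * n\<close>, the first degree where the rule fails, exactly when
    \<open>e \<alpha> = s\<close>. The bound \<open>A \<le> 2 * p\<close> is the inequality
    \<open>s > 2 * (n - p)\<close>.\<close>
  define A where "A = 2 * n + 1 - s"
  have A: "A \<le> 2 * p" "A > 0" "s + A = 2 * n + 1" using s np by (auto simp: A_def)
  define \<kappa> where "\<kappa> = gmoment n (2 * n) - moment (2 * n)"
  have \<kappa>: "\<kappa> \<noteq> 0"
    using gauss_monom_defect[of n] np by (simp add: \<kappa>_def gmoment_def moment_def)
  have core: "(\<Sum>j\<le>p. (\<Sum>k\<le>p. c (?e s j k) * (real s * real k' - real A * real k) * moment (k + k' - 1))
        * moment (j + j')) = 0"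
    if "j' \<le> p" "k' \<le> p + 1" for j' k'
  proof -
    let ?d = "?e A j' k'"
    have "0 = (\<Sum>e\<in>box_exps p. c e * (real (e \<alpha>) * real (?d \<gamma>) - real (e \<gamma>) * real (?d \<alpha>))
           * monomial_defect n (\<lambda>i. if i = \<beta> then e i + ?d i else e i + ?d i - 1))"
      using that p A ne by (subst jacobian_moment_condition[OF ne zero]) auto
    also have "\<dots> = (\<Sum>e\<in>box_exps p. if e \<alpha> = s then
        \<kappa> * (c e * (real s * real k' - real A * real (e \<gamma>)) * moment (e \<gamma> + k' - 1) * moment (e \<beta> + j')) else 0)"
    proof (intro sum.cong refl)
      fix e assume e: "e \<in> box_exps p"
      then have ep: "e i \<le> p" for i by (simp add: box_exps_def)
      let ?D = "monomial_defect n (\<lambda>i. if i = \<beta> then e i + ?d i else e i + ?d i - 1)"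
      have lt: "e \<beta> + j' < 2 * n" "e \<gamma> + k' - 1 < 2 * n"
        using ep[of \<beta>] ep[of \<gamma>] that np by linarith+
      \<comment> \<open>At \<open>s\<close> the two other coordinates are integrated exactly, so the
        defect is \<open>\<kappa>\<close> times their moments. Below \<open>s\<close> the rule is
        exact, and above \<open>s\<close> the coefficient is zero.\<close>
      consider "e \<alpha> = s" | "e \<alpha> < s" | "e \<alpha> > s" by linarith
      then show "c e * (real (e \<alpha>) * real (?d \<gamma>) - real (e \<gamma>) * real (?d \<alpha>)) * ?D
        = (if e \<alpha> = s then \<kappa> * (c e * (real s * real k' - real A * real (e \<gamma>))
            * moment (e \<gamma> + k' - 1) * moment (e \<beta> + j')) else 0)"
      proof cases
        case 1
        then have "?D = \<kappa> * moment (e \<gamma> + k' - 1) * moment (e \<beta> + j')"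
          using ne A lt by (simp add: monomial_defect_def U gmoment_exact \<kappa>_def algebra_simps)
        then show ?thesis using 1 ne by (simp add: mult_ac)
      next
        case 2
        have "?D = 0"
          using 2 ne A lt by (simp add: monomial_defect_def U gmoment_exact)
        then show ?thesis using 2 by simp
      next
        case 3
        then show ?thesis using s_max[OF e] by simp
      qed
    qed
    also have "\<dots> = (\<Sum>i\<le>p. if i = s then \<Sum>j\<le>p. \<Sum>k\<le>p. \<kappa> * (c (?e s j k) *
        (real s * real k' - real A * real k) * moment (k + k' - 1) * moment (j + j')) else 0)"
      unfolding sum_box_exps[OF ne] by (intro sum.cong refl) (use ne in auto)
    also have "\<dots> = \<kappa> * (\<Sum>j\<le>p. (\<Sum>k\<le>p. c (?e s j k) *
        (real s * real k' - real A * real k) * moment (k + k' - 1)) * moment (j + j'))"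
      using s(2) by (simp add: sum_distrib_left sum_distrib_right)
    finally show ?thesis using \<kappa> by simp
  qed
  \<comment> \<open>The system is a tensor product: the moment matrix in \<open>x$\<beta>\<close> is
    inverted first, leaving for each \<open>j\<close> the conditions of
    \<open>euler_moment_nondegenerate\<close> in \<open>x$\<gamma>\<close>.\<close>
  have "(\<Sum>k\<le>p. c (?e s j k) * (real s * real k' - real A * real k) * moment (k + k' - 1)) = 0"
    if "k' \<le> p + 1" "j \<le> p" for j k'
    by (rule moment_nondegenerate[OF core[OF _ that(1)] that(2)])
  then have vanish: "c (?e s j k) = 0" if "j \<le> p" "k \<le> p" for j k
    using that s A(2) by (intro euler_moment_nondegenerate[of A s p "\<lambda>k. c (?e s j k)"]) auto
  have "?e s (e' \<beta>) (e' \<gamma>) = e'"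
  proof
    fix m
    have "m \<in> {\<alpha>, \<beta>, \<gamma>}" by (simp flip: UNIV_eq)
    then show "?e s (e' \<beta>) (e' \<gamma>) m = e' m" using e'(3) by auto
  qed
  moreover have "c (?e s (e' \<beta>) (e' \<gamma>)) = 0"
    using e'(1) by (intro vanish) (simp_all add: box_exps_def)
  ultimately show False using e'(2) by simp
qed

lemma Qsp_of_det_defect:
  assumes "f \<in> Qsp p" "p + 1 \<le> n"
    and zero: "\<And>g h. g \<in> Qsp p \<Longrightarrow> h \<in> Qsp p \<Longrightarrow> det_defect n f g h = 0"
  shows "f \<in> Qsp (min p (2 * (n - p)))"
proof (cases "p \<le> 2 * (n - p)")
  case True
  then show ?thesis using assms(1) by (simp add: min_def)
next
  case False
  let ?r = "2 * (n - p)"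
  obtain c where f: "f = (\<lambda>x. \<Sum>e\<in>box_exps p. c e * monomial e x)"
    using assms(1) by (rule Qsp_E)
  have c0: "c e = 0" if e: "e \<in> box_exps p" "e \<notin> box_exps ?r" for e
  proof -
    obtain \<alpha> where "e \<alpha> > ?r" using e(2) by (auto simp: box_exps_def not_le)
    \<comment> \<open>Since \<open>p + 1 \<le> n\<close>, the case assumption gives
      \<open>p > 2 * (n - p) \<ge> 2\<close>, hence \<open>3 \<le> p\<close>.\<close>
    with e(1) show ?thesis
      using False assms(2) zero[unfolded f]
      by (intro coefficients_vanish[of p n c]) (auto simp: monomial_in_Qsp)
  qed
  have "f x = (\<Sum>e\<in>box_exps ?r. c e * monomial e x)" for x
    unfolding f
  proof (intro sum.mono_neutral_right finite_box_exps)
    show "box_exps ?r \<subseteq> box_exps p"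
      using False by (auto simp: box_exps_def intro: order.trans)
  qed (use c0 in auto)
  then show ?thesis
    using False unfolding Qsp_iff by (auto simp: min_def)
qed

text \<open>Test fields with a single nonzero component, in directions \<open>j\<close> and
  \<open>k\<close>, leave just one of the six determinants; cyclic choices of \<open>i, j, k\<close>
  give it the sign plus.\<close>

lemma det_defect_of_defect:
  assumes z: "z \<in> Qvec p" and zero: "\<And>u v. u \<in> Qvec p \<Longrightarrow> v \<in> Qvec p \<Longrightarrow> defect n z u v = 0"
    and gh: "g \<in> Qsp p" "h \<in> Qsp p"
  shows "det_defect n (\<lambda>x. z x $ i) g h = 0"
proof -
  have zero_in: "(\<lambda>x. 0) \<in> Qsp p"
    unfolding Qsp_iff by (intro exI[of _ "\<lambda>_. 0"]) simp
  have axis_in: "(\<lambda>x. axis j (f x)) \<in> Qvec p" if "f \<in> Qsp p" for j f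
    unfolding Qvec_def mem_Collect_eq
  proof
    fix m show "(\<lambda>x. axis j (f x) $ m) \<in> Qsp p"
      using that zero_in by (cases "m = j") (simp_all add: axis_def)
  qed
  have grad_0: "grad (\<lambda>x. 0) x = 0" for x
    by (rule grad_eqI) simp
  have dd_0: "det_defect n f (\<lambda>x. 0) k = 0" "det_defect n f k (\<lambda>x. 0) = 0" for f k
    by (simp_all add: det_defect_def grad_0 det3_0 tdefect_0)
  have "defect n z (\<lambda>x. axis j (g x)) (\<lambda>x. axis k (h x)) = 0" for j k
    by (intro zero axis_in gh)
  note Z = this[unfolded defect_eq[OF z axis_in[OF gh(1)] axis_in[OF gh(2)]]]
  show ?thesis
    using exhaust_3[of i] Z[of 2 3] Z[of 3 1] Z[of 1 2]
    by (auto simp: axis_def dd_0)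
qed

text \<open>All six determinants are integrated exactly. This serves both the easy inclusion and the
  case \<open>p = 1\<close>.\<close>

lemma defect_exact:
  assumes "z \<in> Qvec r" "u \<in> Qvec p" "v \<in> Qvec p" "r \<le> p" "r + 2 * p \<le> 2 * n" "0 < n"
  shows "defect n z u v = 0"
proof -
  have "z \<in> Qvec p"
    using assms(1) Qsp_mono[OF assms(4)] by (auto simp: Qvec_def)
  moreover have "det_defect n (\<lambda>x. z x $ i) (\<lambda>x. u x $ j) (\<lambda>x. v x $ k) = 0" for i j k
    using assms by (intro det_defect_exact[of _ r _ p]) (auto simp: Qvec_def)
  ultimately show ?thesis
    using assms(2,3) by (simp add: defect_eq)
qed

theorem theorem3:
  shows "(\<forall>p n :: nat. 2 \<le> p \<and> p + 1 \<le> n \<longrightarrow>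
            {z \<in> Qvec p. \<forall>u \<in> Qvec p. \<forall>v \<in> Qvec p. defect n z u v = 0}
              = Qvec (min p (2 * (n - p))))
       \<and> (\<forall>n :: nat. 2 \<le> n \<longrightarrow>
            (\<forall>z \<in> Qvec 1. \<forall>u \<in> Qvec 1. \<forall>v \<in> Qvec 1. defect n z u v = 0))"
proof (intro conjI allI impI ballI)
  fix p n :: nat
  assume pn: "2 \<le> p \<and> p + 1 \<le> n"
  let ?r = "min p (2 * (n - p))"
  show "{z \<in> Qvec p. \<forall>u \<in> Qvec p. \<forall>v \<in> Qvec p. defect n z u v = 0} = Qvec ?r"
  proof (intro subset_antisym subsetI)
    fix z assume "z \<in> {z \<in> Qvec p. \<forall>u \<in> Qvec p. \<forall>v \<in> Qvec p. defect n z u v = 0}"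
    then have z: "z \<in> Qvec p" "\<And>u v. u \<in> Qvec p \<Longrightarrow> v \<in> Qvec p \<Longrightarrow> defect n z u v = 0" by auto
    have "(\<lambda>x. z x $ i) \<in> Qsp ?r" for i
      using z(1) pn det_defect_of_defect[OF z]
      by (intro Qsp_of_det_defect) (auto simp: Qvec_def)
    then show "z \<in> Qvec ?r" by (simp add: Qvec_def)
  next
    fix z assume z: "z \<in> Qvec ?r"
    then have "z \<in> Qvec p"
      using Qsp_mono[of ?r p] by (auto simp: Qvec_def)
    moreover have "defect n z u v = 0" if "u \<in> Qvec p" "v \<in> Qvec p" for u v
      \<comment> \<open>The degree bound follows from \<open>?r \<le> 2 * (n - p)\<close> and
        \<open>p \<le> n\<close>.\<close>
      using pn by (intro defect_exact[OF z that]) auto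
    ultimately show "z \<in> {z \<in> Qvec p. \<forall>u \<in> Qvec p. \<forall>v \<in> Qvec p. defect n z u v = 0}" by simp
  qed
next
  fix n :: nat and z u v
  assume "2 \<le> n" "z \<in> Qvec 1" "u \<in> Qvec 1" "v \<in> Qvec 1"
  then show "defect n z u v = 0" by (intro defect_exact[of z 1 u 1]) auto
qed

end
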